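(* For all integers $n,m\ge1$ with $m\equiv1\pmod 2$, \[ E_{n-1}^{(n)}(x)=(-1)^n\sum_{s=0}^{n-1}\sum_{k=0}^{s}\binom{s}{k}\binom{n-1}{s}(-n)^{s-k}\,T_k^{(n)}(m)\,m^{n-s-1}\,E_{n-1-s}^{(n)}\!\left(\frac{x}{m}\right). \]
   Context: The higher-order Euler polynomials $E_j^{(n)}(x)$ are defined by $\left(\frac{2}{e^t+1}\right)^{n}e^{xt}=\sum_{j\ge0}E_j^{(n)}(x)\frac{t^j}{j!}$. For integers $n\ge0$, $m\ge1$, $k\ge0$, the multiple alternating power sum is \[T_k^{(n)}(m)=\sum_{\substack{0\le v_1,\dots,v_m\le n\\ v_1+\cdots+v_m=n}}\binom{n}{v_1,\dots,v_m}(-1)^{v_1+2v_2+\cdots+mv_m}(v_1+2v_2+\cdots+mv_m)^k,\] with $\binom{n}{v_1,\dots,v_m}$ the multinomial coefficient. *)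

theory Defs
  imports
    "HOL-Computational_Algebra.Formal_Power_Series"
    "HOL-Library.FuncSet"
begin

definition euler_gf :: "nat \<Rightarrow> 'a::field_char_0 \<Rightarrow> 'a fps" where
  "euler_gf n x = (2 / (fps_exp 1 + 1)) ^ n * fps_exp x"

definition euler_poly :: "nat \<Rightarrow> nat \<Rightarrow> 'a::field_char_0 \<Rightarrow> 'a" where
  "euler_poly n j x = fact j * fps_nth (euler_gf n x) j"

lemma euler_poly_gf: "Abs_fps (\<lambda>j. euler_poly n j x / fact j) = euler_gf n x"
  by (simp add: fps_eq_iff euler_poly_def)

text \<open>
  The natural number division below is exact whenever the \<open>v i\<close> sum to \<open>n\<close>.
\<close>

definition multinomial :: "nat \<Rightarrow> 'i set \<Rightarrow> ('i \<Rightarrow> nat) \<Rightarrow> nat" where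
  "multinomial n I v = fact n div (\<Prod>i\<in>I. fact (v i))"

definition alt_power_sum :: "nat \<Rightarrow> nat \<Rightarrow> nat \<Rightarrow> int" where
  "alt_power_sum n k m =
     (\<Sum>v | v \<in> {1..m} \<rightarrow>\<^sub>E {0..n} \<and> (\<Sum>i=1..m. v i) = n.
        int (multinomial n {1..m} v) * (-1) ^ (\<Sum>i=1..m. i * v i)
          * int (\<Sum>i=1..m. i * v i) ^ k)"

end

theory Submission
  imports Defs
begin

text \<open>
  Put \<open>S = (\<Sum>i=1..m. (-e\<^sup>t)\<^sup>i)\<close>. By the multinomial theorem \<open>S\<^sup>n\<close> is the exponential generating
  function of the alternating power sums, while for odd \<open>m\<close> the geometric series gives
  \<open>S (e\<^sup>t + 1) = -e\<^sup>t (e\<^sup>m\<^sup>t + 1)\<close>. Hence multiplying \<open>S\<^sup>n e\<^sup>-\<^sup>n\<^sup>t\<close> by the Euler generating function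
  at \<open>x / m\<close> with \<open>t\<close> replaced by \<open>m t\<close> yields \<open>(-1)\<^sup>n\<close> times the Euler generating function at \<open>x\<close>;
  now compare coefficients.
\<close>

text \<open>This makes the natural-number division in \<open>multinomial\<close> exact. Each
  induction step is the integrality of a binomial coefficient.\<close>

lemma prod_fact_dvd_fact_sum:
  assumes "finite I"
  shows "(\<Prod>i\<in>I. fact (v i)) dvd (fact (\<Sum>i\<in>I. v i) :: nat)"
  using assms
proof (induction I rule: finite_induct)
  case (insert j I)
  have "fact (v j) * (\<Prod>i\<in>I. fact (v i)) dvd (fact (v j) * fact (\<Sum>i\<in>I. v i) :: nat)"
    using insert.IH by (rule mult_dvd_mono[OF dvd_refl])
  also have "\<dots> dvd fact (v j + (\<Sum>i\<in>I. v i))"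
    by (rule fact_fact_dvd_fact)
  finally show ?case
    using insert.hyps by simp
qed simp

text \<open>Choose the \<open>k\<close> of \<open>n\<close> positions that go to \<open>j\<close>,
  then distribute the other \<open>n - k\<close> over \<open>I\<close>.\<close>

lemma multinomial_insert:
  assumes "finite I" "j \<notin> I" "k \<le> n" "(\<Sum>i\<in>I. v i) = n - k"
  shows "multinomial n (insert j I) (v(j := k)) = (n choose k) * multinomial (n - k) I v"
proof -
  let ?p = "(\<Prod>i\<in>I. fact (v i)) :: nat"
  have "(\<Prod>i\<in>I. fact ((v(j := k)) i)) = ?p"
    using assms by (intro prod.cong) auto
  then have prod: "(\<Prod>i\<in>insert j I. fact ((v(j := k)) i)) = fact k * ?p"
    using assms by simp
  \<comment> \<open>\<open>q\<close> is the exact quotient \<open>multinomial (n - k) I v\<close>;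
    with it, both divisions become cancellations.\<close>
  obtain q where q: "fact (n - k) = ?p * q"
    using prod_fact_dvd_fact_sum[OF \<open>finite I\<close>, of v] assms(4) by (auto elim: dvdE)
  have "fact n = fact k * fact (n - k) * (n choose k)"
    using binomial_fact_lemma[OF \<open>k \<le> n\<close>] by simp
  also have "\<dots> = (fact k * ?p) * ((n choose k) * q)"
    by (simp add: q mult_ac)
  finally have n: "fact n = (fact k * ?p) * ((n choose k) * q)" .
  have "?p > 0"
    by (simp add: prod_pos)
  then show ?thesis
    unfolding multinomial_def prod n q by simp
qed

text \<open>Induction on \<open>I\<close>: the binomial theorem splits off \<open>a j\<close>, and
  the hypothesis, needed at every exponent \<open>n - k\<close>, expands the rest.\<close>

lemma multinomial_theorem:
  fixes a :: "'i \<Rightarrow> 'a::comm_semiring_1"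
  assumes "finite I"
  shows "(\<Sum>i\<in>I. a i) ^ n =
    (\<Sum>v | v \<in> I \<rightarrow>\<^sub>E {0..n} \<and> (\<Sum>i\<in>I. v i) = n.
       of_nat (multinomial n I v) * (\<Prod>i\<in>I. a i ^ v i))"
  using assms
proof (induction I arbitrary: n rule: finite_induct)
  case empty
  show ?case
    by (cases "n = 0") (auto simp: multinomial_def power_0_left)
next
  case (insert j I)
  define V where "V I n = {v. v \<in> I \<rightarrow>\<^sub>E {0..n} \<and> (\<Sum>i\<in>I. v i) = n}" for I :: "'i set" and n :: nat
  have fin: "finite (V I k)" for k
    unfolding V_def using insert.hyps
    by (intro finite_subset[OF _ finite_PiE[of I "\<lambda>_. {0..k}"]]) auto
  have upd: "v(j := k) \<in> V (insert j I) n" if "k \<le> n" "v \<in> V I (n - k)" for k v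
  proof -
    have "(\<Sum>i\<in>I. (v(j := k)) i) = (\<Sum>i\<in>I. v i)"
      using insert.hyps by (intro sum.cong) auto
    moreover have "v(j := k) \<in> insert j I \<rightarrow>\<^sub>E {0..n}"
      using that by (auto simp: V_def PiE_iff extensional_def intro: le_trans[OF _ diff_le_self])
    ultimately show ?thesis
      using that insert.hyps by (simp add: V_def)
  qed
  \<comment> \<open>Resetting \<open>j\<close> to \<open>undefined\<close> makes the restriction
    extensional on \<open>I\<close>. The entry bound tightens from \<open>n\<close> to
    \<open>n - w j\<close> because no entry exceeds the sum.\<close>
  have restr: "w j \<le> n \<and> w(j := undefined) \<in> V I (n - w j)" if "w \<in> V (insert j I) n" for w
  proof -
    have sum: "(\<Sum>i\<in>I. (w(j := undefined)) i) = (\<Sum>i\<in>I. w i)"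
      using insert.hyps by (intro sum.cong) auto
    have total: "w j + (\<Sum>i\<in>I. w i) = n"
      using that insert.hyps by (simp add: V_def)
    have "w i \<le> n - w j" if "i \<in> I" for i
      using member_le_sum[OF that, of w] total insert.hyps by simp
    then show ?thesis
      using that sum total insert.hyps by (auto simp: V_def PiE_iff extensional_def)
  qed
  have "(\<Sum>i\<in>insert j I. a i) ^ n = (\<Sum>k\<le>n. of_nat (n choose k) * a j ^ k * (\<Sum>i\<in>I. a i) ^ (n - k))"
    using insert.hyps by (simp add: binomial_ring)
  also have "\<dots> = (\<Sum>k\<le>n. \<Sum>v\<in>V I (n - k).
      of_nat ((n choose k) * multinomial (n - k) I v) * (a j ^ k * (\<Prod>i\<in>I. a i ^ v i)))"
    unfolding insert.IH V_def by (simp add: sum_distrib_left mult_ac)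
  also have "\<dots> = (\<Sum>(k, v)\<in>Sigma {..n} (\<lambda>k. V I (n - k)).
      of_nat ((n choose k) * multinomial (n - k) I v) * (a j ^ k * (\<Prod>i\<in>I. a i ^ v i)))"
    by (rule sum.Sigma) (auto simp: fin)
  also have "\<dots> = (\<Sum>w\<in>V (insert j I) n.
      of_nat (multinomial n (insert j I) w) * (\<Prod>i\<in>insert j I. a i ^ w i))"
  \<comment> \<open>A pair \<open>(k, v)\<close> corresponds to \<open>v(j := k)\<close>;
    extensionality of \<open>v\<close> lets the inverse map recover it.\<close>
  proof (rule sum.reindex_bij_witness[where
        i = "\<lambda>w. (w j, w(j := undefined))" and j = "\<lambda>(k, v). v(j := k)"])
    fix p assume p: "p \<in> Sigma {..n} (\<lambda>k. V I (n - k))"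
    obtain k v where kv: "p = (k, v)" "k \<le> n" "v \<in> V I (n - k)"
      using p by auto
    have "v j = undefined"
      using kv(3) insert.hyps by (auto simp: V_def PiE_iff extensional_def)
    then show "(\<lambda>w. (w j, w(j := undefined))) ((\<lambda>(k, v). v(j := k)) p) = p"
      using kv by (auto simp: fun_eq_iff)
    show "(\<lambda>(k, v). v(j := k)) p \<in> V (insert j I) n"
      using kv upd by simp
    have "(\<Prod>i\<in>I. a i ^ (v(j := k)) i) = (\<Prod>i\<in>I. a i ^ v i)"
      using insert.hyps by (intro prod.cong) auto
    then have "(\<Prod>i\<in>insert j I. a i ^ (v(j := k)) i) = a j ^ k * (\<Prod>i\<in>I. a i ^ v i)"
      using insert.hyps by simp
    moreover have "multinomial n (insert j I) (v(j := k)) = (n choose k) * multinomial (n - k) I v"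
      using kv insert.hyps by (intro multinomial_insert) (auto simp: V_def)
    ultimately show "of_nat (multinomial n (insert j I) ((\<lambda>(k, v). v(j := k)) p)) *
        (\<Prod>i\<in>insert j I. a i ^ ((\<lambda>(k, v). v(j := k)) p) i) =
        (case p of (k, v) \<Rightarrow>
          of_nat ((n choose k) * multinomial (n - k) I v) * (a j ^ k * (\<Prod>i\<in>I. a i ^ v i)))"
      by (simp only: kv prod.case)
  next
    fix w assume w: "w \<in> V (insert j I) n"
    then show "(\<lambda>(k, v). v(j := k)) (w j, w(j := undefined)) = w"
      and "(w j, w(j := undefined)) \<in> Sigma {..n} (\<lambda>k. V I (n - k))"
      using restr by auto
  qed
  finally show ?case
    by (simp add: V_def)
qed

text \<open>With w = v_1 + 2 v_2 + ... + m v_m, each multinomial term contributes (-1)^w e^(wt),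
  whose coefficient at t^k is (-1)^w w^k / k!.\<close>

lemma fps_nth_alternating_exp_sum_power:
  "fps_nth ((\<Sum>i=1..m. (- fps_exp (1::'a::field_char_0)) ^ i) ^ n) k =
     of_int (alt_power_sum n k m) / fact k"
proof -
  have "(\<Prod>i=1..m. ((- fps_exp (1::'a)) ^ i) ^ v i) =
      fps_const ((-1) ^ (\<Sum>i=1..m. i * v i)) * fps_exp (of_nat (\<Sum>i=1..m. i * v i))" for v
  proof -
    have "(\<Prod>i=1..m. ((- fps_exp (1::'a)) ^ i) ^ v i) = (- fps_exp 1) ^ (\<Sum>i=1..m. i * v i)"
      by (simp add: power_sum power_mult)
    also have "\<dots> = (-1) ^ (\<Sum>i=1..m. i * v i) * fps_exp 1 ^ (\<Sum>i=1..m. i * v i)"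
      by (rule power_minus)
    also have "(-1 :: 'a fps) = fps_const (-1)"
      by (simp flip: fps_const_neg)
    finally show ?thesis
      by (simp only: fps_const_power fps_exp_power_mult mult_1_right)
  qed
  then have coeff: "fps_nth (of_nat c * (\<Prod>i=1..m. ((- fps_exp (1::'a)) ^ i) ^ v i)) k =
      of_int (int c * (-1) ^ (\<Sum>i=1..m. i * v i) * int (\<Sum>i=1..m. i * v i) ^ k) / fact k" for c v
    by (simp flip: fps_of_nat add: mult.assoc)
  show ?thesis
    unfolding multinomial_theorem[OF finite_atLeastAtMost] fps_sum_nth coeff alt_power_sum_def
      of_int_sum sum_divide_distrib ..
qed

lemma sum_odd_powers_uminus:
  fixes y :: "'a::comm_ring_1"
  assumes "odd m"
  shows "(\<Sum>i=1..m. (- y) ^ i) * (y + 1) = - y * (y ^ m + 1)"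
proof -
  \<comment> \<open>The sum telescopes for every \<open>k\<close>, so induction works; parity enters
    only at \<open>k = m\<close>, turning \<open>(- y) ^ Suc m\<close> into
    \<open>y ^ Suc m\<close>.\<close>
  have "(\<Sum>i=1..k. (- y) ^ i) * (y + 1) = - y - (- y) ^ Suc k" for k
    by (induction k) (simp_all add: algebra_simps)
  from this[of m] show ?thesis
    using assms by (simp add: algebra_simps)
qed

lemma euler_gf_distribution:
  fixes x :: "'a::field_char_0"
  assumes "odd m"
  shows "(\<Sum>i=1..m. (- fps_exp 1) ^ i) ^ n * fps_exp (- of_nat n) *
      (euler_gf n (x / of_nat m) oo (fps_const (of_nat m) * fps_X)) = (-1) ^ n * euler_gf n x"
proof -
  define E where "E = fps_exp (1::'a)"
  define D where "D = E + 1"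
  define D' where "D' = E ^ m + 1"
  define c :: "'a fps" where "c = fps_const (of_nat m) * fps_X"
  define S where "S = (\<Sum>i=1..m. (- E) ^ i)"
  have m: "of_nat m \<noteq> (0::'a)"
    using assms by (auto elim: oddE)
  have c0: "fps_nth c 0 = 0"
    by (simp add: c_def)
  have D0: "fps_nth D 0 \<noteq> 0"
    by (simp add: D_def E_def)
  then have "D \<noteq> 0"
    by auto
  \<comment> \<open>\<open>D\<close> has constant term 2, so it is a unit and the division is
    genuine.\<close>
  have half: "2 / D * D = 2"
    using D0 by (simp add: fps_divide_unit mult.assoc inverse_mult_eq_1)
  have "D oo c = D'"
    by (simp add: D_def D'_def E_def c_def fps_compose_add_distrib fps_exp_power_mult)
  moreover have "2 oo c = 2"
    by (simp add: numeral_fps_const)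
  \<comment> \<open>Substituting \<open>c\<close> into \<open>half\<close> describes the composed
    quotient by a product, without computing an inverse of \<open>D'\<close>.\<close>
  ultimately have half': "(2 / D oo c) * D' = 2"
    using arg_cong[OF half, of "\<lambda>f. f oo c"] by (simp add: fps_compose_mult_distrib[OF c0])
  \<comment> \<open>The substitution scales the exponent \<open>x / of_nat m\<close> back to
    \<open>x\<close>, which requires \<open>m\<close> to be nonzero.\<close>
  have gf: "euler_gf n (x / of_nat m) oo c = (2 / D oo c) ^ n * fps_exp x"
    using m unfolding euler_gf_def D_def[symmetric] E_def[symmetric]
      fps_compose_mult_distrib[OF c0] fps_compose_power[OF c0, symmetric]
    by (simp add: c_def)
  have exp: "E ^ n * fps_exp (- of_nat n) = 1"
    by (simp add: E_def fps_exp_power_mult flip: fps_exp_add_mult)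
  \<comment> \<open>Both sides are compared after multiplication by \<open>D ^ n\<close>, so that
    \<open>S * D\<close> can be replaced; the factor is cancelled at the end.\<close>
  have "S ^ n * fps_exp (- of_nat n) * (euler_gf n (x / of_nat m) oo c) * D ^ n =
      (S * D) ^ n * fps_exp (- of_nat n) * ((2 / D oo c) ^ n * fps_exp x)"
    unfolding gf by (simp add: power_mult_distrib mult_ac)
  also have "S * D = - E * D'"
    unfolding S_def D_def D'_def by (rule sum_odd_powers_uminus[OF assms])
  also have "(- E * D') ^ n * fps_exp (- of_nat n) * ((2 / D oo c) ^ n * fps_exp x) =
      (-1) ^ n * (E ^ n * fps_exp (- of_nat n)) * ((2 / D oo c) * D') ^ n * fps_exp x"
    by (simp only: power_mult_distrib power_minus[of E] mult_ac)
  also have "\<dots> = (-1) ^ n * (2 / D * D) ^ n * fps_exp x"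
    by (simp add: exp half half')
  also have "\<dots> = (-1) ^ n * euler_gf n x * D ^ n"
    unfolding euler_gf_def D_def[symmetric] E_def[symmetric] power_mult_distrib by (simp add: mult_ac)
  finally have "S ^ n * fps_exp (- of_nat n) * (euler_gf n (x / of_nat m) oo c) =
      (-1) ^ n * euler_gf n x"
    using \<open>D \<noteq> 0\<close> by simp
  then show ?thesis
    by (simp add: S_def c_def E_def)
qed

lemma euler_poly_distribution:
  fixes x :: "'a::field_char_0"
  assumes "odd m"
  shows "euler_poly n N x =
    (-1) ^ n * (\<Sum>s=0..N. \<Sum>k=0..s.
       of_nat (s choose k) * of_nat (N choose s) * (- of_nat n) ^ (s - k)
         * of_int (alt_power_sum n k m) * of_nat m ^ (N - s) * euler_poly n (N - s) (x / of_nat m))"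
proof -
  let ?S = "(\<Sum>i=1..m. (- fps_exp (1::'a)) ^ i) ^ n"
  let ?e = "fps_exp (- of_nat n :: 'a)"
  let ?G = "euler_gf n (x / of_nat m) oo (fps_const (of_nat m) * fps_X)"
  have sign: "(-1 :: 'a fps) ^ n = fps_const ((-1) ^ n)"
    by (simp flip: fps_const_power fps_const_neg)
  \<comment> \<open>The factorials combine as N! / (k! (s-k)! (N-s)!) = binom(s,k) binom(N,s); the
    factor \<open>of_nat m ^ (N - s)\<close> comes from the substitution in
    \<open>?G\<close>.\<close>
  have coeff: "fact N * (fps_nth ?S k * fps_nth ?e (s - k) * fps_nth ?G (N - s)) =
      of_nat (s choose k) * of_nat (N choose s) * (- of_nat n) ^ (s - k)
        * of_int (alt_power_sum n k m) * of_nat m ^ (N - s) * euler_poly n (N - s) (x / of_nat m)"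
    if "s \<le> N" "k \<le> s" for s k
    unfolding fps_nth_alternating_exp_sum_power euler_poly_def fps_nth_compose_linear
    using that by (simp add: binomial_fact field_simps)
  \<comment> \<open>The sign squares to 1, so it may be inserted twice: one copy stays outside, the
    other is absorbed by the generating function identity.\<close>
  have "euler_poly n N x = (-1) ^ n * (fact N * fps_nth ((-1) ^ n * euler_gf n x) N)"
    unfolding sign euler_poly_def by (simp add: mult.left_commute[of "fact N"])
  also have "\<dots> = (-1) ^ n * (fact N * fps_nth (?S * ?e * ?G) N)"
    by (simp only: euler_gf_distribution[OF assms])
  also have "fact N * fps_nth (?S * ?e * ?G) N =
      (\<Sum>s=0..N. \<Sum>k=0..s. fact N * (fps_nth ?S k * fps_nth ?e (s - k) * fps_nth ?G (N - s)))"
    unfolding fps_mult_nth[of "?S * ?e"] fps_mult_nth[of ?S] sum_distrib_left sum_distrib_right ..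
  also have "\<dots> = (\<Sum>s=0..N. \<Sum>k=0..s.
      of_nat (s choose k) * of_nat (N choose s) * (- of_nat n) ^ (s - k)
        * of_int (alt_power_sum n k m) * of_nat m ^ (N - s) * euler_poly n (N - s) (x / of_nat m))"
    by (intro sum.cong refl coeff) auto
  finally show ?thesis .
qed

theorem theorem4:
  fixes n m :: nat and x :: "'a::field_char_0"
  assumes "n \<ge> 1" and "m \<ge> 1" and "m mod 2 = 1"
  shows "euler_poly n (n - 1) x =
    (-1) ^ n * (\<Sum>s=0..n-1. \<Sum>k=0..s.
       of_nat (s choose k) * of_nat ((n - 1) choose s) * (- of_nat n) ^ (s - k)
         * of_int (alt_power_sum n k m) * of_nat m ^ (n - s - 1)
         * euler_poly n (n - 1 - s) (x / of_nat m))"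
proof -
  have "odd m"
    using assms(3) by presburger
  \<comment> \<open>At \<open>N = n - 1\<close> only the order of subtraction in the exponent of
    \<open>of_nat m\<close> differs.\<close>
  from euler_poly_distribution[OF this, of n "n - 1" x] show ?thesis
    by (simp only: diff_commute[of n _ 1])
qed

end
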